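(* Let $r\geq 2$, let $n\in\mathbb{N}$ be sufficiently large, let $1\leq b\leq 2^{-10}r^{-2}n$, and set $\alpha=(r+1)/(2r)$. Let $G_\alpha$ be a graph on $n$ vertices with $\delta(G_\alpha)\geq \alpha n$ and let $\chi$ be an $r$-colouring of $E(G_\alpha)$. If each Hamilton cycle in $G_\alpha$ has at most $b$ colour bias in $\chi$, then there exist a set $U\subset V(G_\alpha)$ with $|U|=\alpha n$ and a colour $c^*\in[r]$ such that $$e(M)<2^{9}r\cdot b$$ holds for every matching $M\subset G_\alpha[U]$ that has no edges of colour $c^*$.
   Context: $\delta(G)$ is the minimum degree, $e(M)$ the number of edges of $M$, and $G[U]$ the subgraph of $G$ induced by $U$. An $r$-colouring is an arbitrary map from the edge set to $[r]=\{1,\dots,r\}$. The colour bias of a Hamilton cycle $H$ of an $n$-vertex graph in $\chi$ is the maximum over colours $c\in[r]$ of (number of edges of $H$ of colour $c$) $-\,n/r$; so having at most $b$ colour bias means containing at most $n/r+b$ edges of each colour. Rounding is ignored: $\alpha n$ is treated as an integer. *)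

theory Defs
  imports Complex_Main
begin

text \<open>A graph is given by its vertex set \<open>V\<close> and its set \<open>E\<close> of edges, each edge being the
  two-element set of its endpoints.\<close>

definition simple_graph :: "'a set \<Rightarrow> 'a set set \<Rightarrow> bool" where
  "simple_graph V E \<longleftrightarrow> finite V \<and> (\<forall>e\<in>E. e \<subseteq> V \<and> card e = 2)"

definition degree :: "'a set set \<Rightarrow> 'a \<Rightarrow> nat" where
  "degree E v = card {e \<in> E. v \<in> e}"

definition min_degree :: "'a set \<Rightarrow> 'a set set \<Rightarrow> nat" where
  "min_degree V E = Min (degree E ` V)"

definition induced_edges :: "'a set set \<Rightarrow> 'a set \<Rightarrow> 'a set set" where
  "induced_edges E U = {e \<in> E. e \<subseteq> U}"

definition matching :: "'a set set \<Rightarrow> 'a set set \<Rightarrow> bool" where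
  "matching E M \<longleftrightarrow> M \<subseteq> E \<and> (\<forall>e\<in>M. \<forall>f\<in>M. e \<noteq> f \<longrightarrow> e \<inter> f = {})"

definition cycle_edges :: "'a list \<Rightarrow> 'a set set" where
  "cycle_edges vs = {{vs ! i, vs ! (Suc i mod length vs)} | i. i < length vs}"

text \<open>Hamilton cycles are identified with their edge sets.\<close>

definition hamilton_cycle :: "'a set \<Rightarrow> 'a set set \<Rightarrow> 'a set set \<Rightarrow> bool" where
  "hamilton_cycle V E H \<longleftrightarrow>
     (\<exists>vs. distinct vs \<and> set vs = V \<and> 3 \<le> length vs \<and> H = cycle_edges vs \<and> H \<subseteq> E)"

text \<open>Values of a colouring outside the edge set are irrelevant.\<close>

definition edge_colouring :: "nat \<Rightarrow> 'a set set \<Rightarrow> ('a set \<Rightarrow> nat) \<Rightarrow> bool" where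
  "edge_colouring r E \<chi> \<longleftrightarrow> \<chi> ` E \<subseteq> {1..r}"

definition colour_bias :: "nat \<Rightarrow> 'a set \<Rightarrow> ('a set \<Rightarrow> nat) \<Rightarrow> 'a set set \<Rightarrow> real" where
  "colour_bias r V \<chi> H =
     Max ((\<lambda>c. real (card {e \<in> H. \<chi> e = c}) - real (card V) / real r) ` {1..r})"

end

(* Call two paths with the same vertex set and the same ends, but with different colour
   multisets, a switch. Among more than 2rb disjoint switches at least half change the number of
   edges whose colour lies in a suitable set T of colours. By a rotation argument (Posa's
   strengthening of Dirac's theorem, with room n/r in the degree condition) some Hamilton cycle
   runs through all switches; using each switch in the two possible directions gives two
   Hamilton cycles whose numbers of T-coloured edges differ by more than rb, which is impossible.
   Hence a maximal family of disjoint switches meets only a set W of O(rb) vertices.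

   Moving a vertex v from an edge ab to a disjoint edge cd inside its neighbourhood is a switch
   a v b w c d -> a b w c v d unless [va] + [vb] - [ab] = [vc] + [vd] - [cd] as formal sums of
   colours. So outside W this sum depends on v only, and for some v it forces all edges within
   N(v) - W to have one colour c*. Take U inside N(v): a matching in U avoiding c* has each
   edge meeting W. *)

theory Submission
  imports Defs "HOL-Library.Multiset"
begin

section \<open>Paths as lists\<close>

text \<open>Edges are kept as lists so that counts are lengths of filters and add up over
  concatenation; for a Hamilton cycle distinctness turns these counts into cardinalities.\<close>

fun path_edges :: "'a list \<Rightarrow> 'a set list" where
  "path_edges (x # y # zs) = {x, y} # path_edges (y # zs)"
| "path_edges _ = []"

definition closed_path_edges :: "'a list \<Rightarrow> 'a set list" where
  "closed_path_edges vs = path_edges vs @ [{last vs, hd vs}]"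

lemma path_edges_append:
  "xs \<noteq> [] \<Longrightarrow> ys \<noteq> [] \<Longrightarrow>
    path_edges (xs @ ys) = path_edges xs @ {last xs, hd ys} # path_edges ys"
proof (induction xs rule: path_edges.induct)
  case ("2_2" v)
  then show ?case by (cases ys) auto
qed auto

lemma path_edges_rev: "path_edges (rev xs) = rev (path_edges xs)"
proof (induction xs rule: path_edges.induct)
  case (1 x y zs)
  then show ?case
    using path_edges_append[of "rev zs @ [y]" "[x]"] by (simp add: insert_commute)
qed auto

lemma length_path_edges: "length (path_edges xs) = length xs - 1"
  by (induction xs rule: path_edges.induct) auto

lemma set_path_edges: "set (path_edges xs) = {{xs ! i, xs ! Suc i} | i. Suc i < length xs}"
proof (induction xs rule: path_edges.induct)
  case (1 x y zs)
  have "{{(x # y # zs) ! i, (x # y # zs) ! Suc i} | i. Suc i < length (x # y # zs)}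
      = insert {x, y} {{(y # zs) ! i, (y # zs) ! Suc i} | i. Suc i < length (y # zs)}" (is "?L = ?R")
  proof (intro set_eqI iffI)
    fix e assume "e \<in> ?L"
    then obtain i where "e = {(x # y # zs) ! i, (x # y # zs) ! Suc i}" "Suc i < length (x # y # zs)"
      by blast
    then show "e \<in> ?R" by (cases i) auto
  next
    fix e assume "e \<in> ?R"
    then consider "e = {x, y}" | i where "e = {(y # zs) ! i, (y # zs) ! Suc i}" "Suc i < length (y # zs)"
      by blast
    then show "e \<in> ?L"
    proof cases
      case 1
      then show ?thesis by (auto intro!: exI[of _ 0])
    next
      case 2
      then show ?thesis by (auto intro!: exI[of _ "Suc i"])
    qed
  qed
  with 1 show ?case by simp
qed auto

lemma path_edges_subset: "e \<in> set (path_edges xs) \<Longrightarrow> e \<subseteq> set xs"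
  by (induction xs rule: path_edges.induct) auto

lemma distinct_path_edges: "distinct xs \<Longrightarrow> distinct (path_edges xs)"
proof (induction xs rule: path_edges.induct)
  case (1 x y zs)
  then show ?case using path_edges_subset[of "{x, y}" "y # zs"] by auto
qed auto

text \<open>The closing edge joins the two ends of the path, and with at least three vertices no
  path edge does so.\<close>

lemma distinct_closed_path_edges:
  assumes "distinct vs" "3 \<le> length vs"
  shows "distinct (closed_path_edges vs)"
proof -
  obtain x y zs where vs: "vs = x # y # zs" and "zs \<noteq> []"
    using assms(2) by (cases vs; cases "tl vs"; cases "tl (tl vs)") auto
  then have "last vs \<in> set zs" by simp
  with assms(1) vs have "{last vs, x} \<noteq> {x, y}" by (auto simp: doubleton_eq_iff)
  moreover have "{last vs, x} \<notin> set (path_edges (y # zs))"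
    using path_edges_subset[of "{last vs, x}" "y # zs"] assms(1) vs by auto
  ultimately show ?thesis
    using distinct_path_edges[OF assms(1)] by (simp add: closed_path_edges_def vs)
qed

text \<open>The reduction modulo the length takes effect only at the last index, where it produces
  the closing edge.\<close>

lemma cycle_edges_eq_closed_path_edges:
  assumes "vs \<noteq> []"
  shows "cycle_edges vs = set (closed_path_edges vs)"
proof -
  have "cycle_edges vs = {{vs ! i, vs ! (Suc i mod length vs)} | i. Suc i < length vs}
      \<union> {{vs ! i, vs ! (Suc i mod length vs)} | i. Suc i = length vs}"
    unfolding cycle_edges_def by (auto simp: less_Suc_eq_le dest: Suc_leI le_neq_implies_less)
  also have "{{vs ! i, vs ! (Suc i mod length vs)} | i. Suc i < length vs} = set (path_edges vs)"
    unfolding set_path_edges by (rule Collect_cong, rule iff_exI) auto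
  also have "{{vs ! i, vs ! (Suc i mod length vs)} | i. Suc i = length vs} = {{last vs, hd vs}}"
  proof -
    obtain k where k: "length vs = Suc k" using assms by (cases vs) auto
    have "last vs = vs ! k" "hd vs = vs ! 0"
      using assms k by (simp_all add: last_conv_nth hd_conv_nth)
    then show ?thesis using k by auto
  qed
  finally show ?thesis by (simp add: closed_path_edges_def)
qed

section \<open>Blocks and rotations\<close>

text \<open>A block offers two interchangeable paths on the same vertices with the same ends. In a
  cyclic arrangement of blocks the choice of the path within each block is free.\<close>

definition block :: "'a set set \<Rightarrow> 'a list \<times> 'a list \<Rightarrow> bool" where
  "block E B \<longleftrightarrow> fst B \<noteq> [] \<and> mset (fst B) = mset (snd B) \<and>
     hd (fst B) = hd (snd B) \<and> last (fst B) = last (snd B) \<and>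
     set (path_edges (fst B)) \<subseteq> E \<and> set (path_edges (snd B)) \<subseteq> E"

definition flip :: "'a list \<times> 'a list \<Rightarrow> 'a list \<times> 'a list" where
  "flip B = (rev (fst B), rev (snd B))"

text \<open>The ends may be read off the first path alone, since both paths of a block share
  them.\<close>

definition lend :: "'a list \<times> 'a list \<Rightarrow> 'a" where "lend B = hd (fst B)"
definition rend :: "'a list \<times> 'a list \<Rightarrow> 'a" where "rend B = last (fst B)"

fun links :: "('a list \<times> 'a list) list \<Rightarrow> 'a set list" where
  "links (B # C # Bs) = {rend B, lend C} # links (C # Bs)"
| "links _ = []"

definition closed_links :: "('a list \<times> 'a list) list \<Rightarrow> 'a set list" where
  "closed_links Bs = links Bs @ [{rend (last Bs), lend (hd Bs)}]"

text \<open>Links between consecutive blocks may be non-edges at first. Their number is the measure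
  that rotations decrease; at 0 the arrangement is a Hamilton cycle.\<close>

definition bad_links :: "'a set set \<Rightarrow> ('a list \<times> 'a list) list \<Rightarrow> nat" where
  "bad_links E Bs = length (filter (\<lambda>e. e \<notin> E) (closed_links Bs))"

text \<open>Rotation moves the cut of the cyclic arrangement; reversing a segment (with its blocks)
  is the Posa-type exchange of two links. Both keep the blocks up to direction.\<close>

inductive rearranged :: "('a list \<times> 'a list) list \<Rightarrow> ('a list \<times> 'a list) list \<Rightarrow> bool" for Bs where
  same: "rearranged Bs Bs"
| rotate: "rearranged Bs (Xs @ Ys) \<Longrightarrow> rearranged Bs (Ys @ Xs)"
| reverse: "rearranged Bs (Xs @ Ys) \<Longrightarrow> rearranged Bs (rev (map flip Xs) @ Ys)"

text \<open>Disjointness and covering are stated for the first paths only; the second paths inherit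
  both, as each block has equal vertex multisets.\<close>

definition block_partition :: "'a set \<Rightarrow> 'a set set \<Rightarrow> ('a list \<times> 'a list) list \<Rightarrow> bool" where
  "block_partition V E Bs \<longleftrightarrow> (\<forall>B\<in>set Bs. block E B) \<and>
     distinct (concat (map fst Bs)) \<and> set (concat (map fst Bs)) = V"

section \<open>Invariants of rearrangement\<close>

lemma rearranged_trans: "rearranged Bs Cs \<Longrightarrow> rearranged As Bs \<Longrightarrow> rearranged As Cs"
  by (induction rule: rearranged.induct) (auto intro: rearranged.intros)

lemma block_flip: "block E B \<Longrightarrow> block E (flip B)"
  using mset_eq_setD[of "fst B" "snd B"]
  by (auto simp: block_def flip_def path_edges_rev hd_rev last_rev)

lemma mset_concat_fst_flip:
  "mset (concat (map fst (rev (map flip Bs)))) = mset (concat (map fst Bs))"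
  by (induction Bs) (auto simp: flip_def)

lemma rearranged_length: "rearranged Bs Cs \<Longrightarrow> length Cs = length Bs"
  by (induction rule: rearranged.induct) auto

text \<open>Meant for colour counts of the block paths, which do not depend on direction.\<close>

lemma rearranged_sum_list:
  fixes w :: "'a list \<times> 'a list \<Rightarrow> 'b::comm_monoid_add"
  assumes "rearranged Bs Cs" "\<And>B. w (flip B) = w B"
  shows "sum_list (map w Cs) = sum_list (map w Bs)"
  using assms(1)
proof (induction rule: rearranged.induct)
  case (reverse Xs Ys)
  have "sum_list (map w (rev (map flip Xs))) = sum_list (map w Xs)"
    by (simp add: rev_map[symmetric] sum_list.rev o_def assms(2))
  with reverse show ?case by simp
qed (auto simp: add.commute)

lemma rearranged_block_partition:
  assumes "rearranged Bs Cs" "block_partition V E Bs"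
  shows "block_partition V E Cs"
proof -
  have "mset (concat (map fst Cs)) = mset (concat (map fst Bs)) \<and> (\<forall>B\<in>set Cs. block E B)"
    using assms(1)
  proof (induction rule: rearranged.induct)
    case same
    then show ?case using assms(2) by (simp add: block_partition_def)
  next
    case (rotate Xs Ys)
    then show ?case by (auto simp: add.commute)
  next
    case (reverse Xs Ys)
    have "mset (concat (map fst (rev (map flip Xs) @ Ys))) = mset (concat (map fst (Xs @ Ys)))"
      using mset_concat_fst_flip[of Xs] by simp
    moreover have "block E B" if "B \<in> set (rev (map flip Xs) @ Ys)" for B
    proof -
      have "B \<in> flip ` set Xs \<or> B \<in> set Ys" using that by simp
      then show ?thesis using reverse.IH block_flip by fastforce
    qed
    ultimately show ?case using reverse.IH by metis
  qed
  then show ?thesis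
    using assms(2) unfolding block_partition_def
    by (metis mset_eq_imp_distinct_iff mset_eq_setD)
qed

section \<open>Links under concatenation and reversal\<close>

lemma links_append:
  "Xs \<noteq> [] \<Longrightarrow> Ys \<noteq> [] \<Longrightarrow>
    links (Xs @ Ys) = links Xs @ {rend (last Xs), lend (hd Ys)} # links Ys"
proof (induction Xs rule: links.induct)
  case ("2_2" v)
  then show ?case by (cases Ys) auto
qed auto

lemma lend_flip: "fst B \<noteq> [] \<Longrightarrow> lend (flip B) = rend B"
  and rend_flip: "fst B \<noteq> [] \<Longrightarrow> rend (flip B) = lend B"
  by (auto simp: lend_def rend_def flip_def hd_rev last_rev)

lemma links_reverse:
  "(\<And>B. B \<in> set Bs \<Longrightarrow> fst B \<noteq> []) \<Longrightarrow> links (rev (map flip Bs)) = rev (links Bs)"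
proof (induction Bs rule: links.induct)
  case (1 B C Bs)
  then show ?case
    using links_append[of "rev (map flip Bs) @ [flip C]" "[flip B]"]
    by (simp add: lend_flip rend_flip insert_commute)
qed auto

lemma links_split:
  "e \<in> set (links Bs) \<Longrightarrow>
    \<exists>Xs Ys. Xs \<noteq> [] \<and> Ys \<noteq> [] \<and> Bs = Xs @ Ys \<and> e = {rend (last Xs), lend (hd Ys)}"
proof (induction Bs rule: links.induct)
  case (1 B C Bs)
  show ?case
  proof (cases "e = {rend B, lend C}")
    case True
    then show ?thesis by (intro exI[of _ "[B]"] exI[of _ "C # Bs"]) auto
  next
    case False
    with 1 obtain Xs Ys where "Xs \<noteq> []" "Ys \<noteq> []" "C # Bs = Xs @ Ys"
      "e = {rend (last Xs), lend (hd Ys)}" by auto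
    then show ?thesis by (intro exI[of _ "B # Xs"] exI[of _ Ys]) auto
  qed
qed auto

lemma bad_links_rotate: "bad_links E (Ys @ Xs) = bad_links E (Xs @ Ys)"
  by (cases "Xs = [] \<or> Ys = []") (auto simp: bad_links_def closed_links_def links_append)

text \<open>The link term does not depend on \<open>f\<close>, so the cycles obtained from
  \<open>fst\<close> and from \<open>snd\<close> differ only inside the blocks.\<close>

lemma length_filter_path_edges_concat:
  assumes "Bs \<noteq> []" "\<And>B. B \<in> set Bs \<Longrightarrow> f B \<noteq> [] \<and> hd (f B) = lend B \<and> last (f B) = rend B"
  shows "length (filter P (closed_path_edges (concat (map f Bs)))) =
    length (filter P (closed_links Bs)) + (\<Sum>B\<leftarrow>Bs. length (filter P (path_edges (f B))))"
proof -
  \<comment> \<open>The induction also carries the ends of the concatenation, which determine the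
    next link and the closing edge.\<close>
  have "length (filter P (path_edges (concat (map f Bs)))) =
      length (filter P (links Bs)) + (\<Sum>B\<leftarrow>Bs. length (filter P (path_edges (f B))))
    \<and> hd (concat (map f Bs)) = lend (hd Bs) \<and> last (concat (map f Bs)) = rend (last Bs)"
    using assms
  proof (induction Bs rule: links.induct)
    case (1 B C Bs)
    then have IH: "length (filter P (path_edges (concat (map f (C # Bs))))) =
        length (filter P (links (C # Bs))) + (\<Sum>B\<leftarrow>C # Bs. length (filter P (path_edges (f B))))"
      "hd (concat (map f (C # Bs))) = lend C" "last (concat (map f (C # Bs))) = rend (last (C # Bs))"
      by auto
    have ne: "f B \<noteq> []" "hd (f B) = lend B" "last (f B) = rend B" "concat (map f (C # Bs)) \<noteq> []"
      using 1(3) by auto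
    have eq: "concat (map f (B # C # Bs)) = f B @ concat (map f (C # Bs))" by simp
    show ?case
      unfolding eq path_edges_append[OF ne(1,4)] using IH ne by auto
  qed auto
  then show ?thesis by (simp add: closed_path_edges_def closed_links_def)
qed

section \<open>Hamilton cycles through prescribed blocks\<close>

definition nbrs :: "'a set set \<Rightarrow> 'a \<Rightarrow> 'a set" where
  "nbrs E v = {u. {v, u} \<in> E}"

lemma nbrs_subset:
  assumes "simple_graph V E"
  shows "nbrs E v \<subseteq> V - {v}"
  using assms by (fastforce simp: simple_graph_def nbrs_def)

lemma finite_nbrs: "simple_graph V E \<Longrightarrow> finite (nbrs E v)"
  using nbrs_subset[of V E v] by (auto simp: simple_graph_def intro: finite_subset)

lemma card_nbrs:
  assumes "simple_graph V E"
  shows "card (nbrs E v) = degree E v"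
proof -
  have "bij_betw (\<lambda>u. {v, u}) (nbrs E v) {e \<in> E. v \<in> e}"
  proof (rule bij_betw_imageI)
    show "inj_on (\<lambda>u. {v, u}) (nbrs E v)" by (auto simp: inj_on_def doubleton_eq_iff)
    show "(\<lambda>u. {v, u}) ` nbrs E v = {e \<in> E. v \<in> e}"
    proof (intro set_eqI iffI)
      fix e assume e: "e \<in> {e \<in> E. v \<in> e}"
      then have "card e = 2" using assms by (auto simp: simple_graph_def)
      then obtain x y where "e = {x, y}" by (auto simp: card_2_iff)
      with e show "e \<in> (\<lambda>u. {v, u}) ` nbrs E v"
        by (auto simp: nbrs_def insert_commute image_iff)
    qed (auto simp: nbrs_def)
  qed
  then show ?thesis by (simp add: degree_def bij_betw_same_card)
qed

lemma distinct_map_end: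
  assumes "distinct (concat (map fst Bs))" "\<And>B. B \<in> set Bs \<Longrightarrow> g B \<in> set (fst B)"
  shows "distinct (map g Bs)"
  using assms
proof (induction Bs)
  case (Cons A Bs)
  have "g A \<noteq> g B" if "B \<in> set Bs" for B
    using Cons.prems(1) Cons.prems(2)[of A] Cons.prems(2)[of B] that by auto
  then show ?case using Cons by auto
qed simp

text \<open>The chosen ends are distinct vertices, one per block, so at most
  \<open>card V - length Bs\<close> neighbours of a given end are not chosen ends
  themselves.\<close>

lemma card_end_nbrs:
  assumes graph: "simple_graph V E"
    and part: "distinct (concat (map fst Bs))" "set (concat (map fst Bs)) = V"
    and g: "\<And>B. B \<in> set Bs \<Longrightarrow> g B \<in> set (fst B)"
    and j: "j < length Bs"
  shows "card (nbrs E (g (Bs ! j))) + length Bs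
    \<le> card {i. i < length Bs \<and> i \<noteq> j \<and> {g (Bs ! j), g (Bs ! i)} \<in> E} + card V"
proof -
  let ?m = "length Bs" and ?y = "g (Bs ! j)"
  let ?A = "{i. i < ?m \<and> i \<noteq> j \<and> {?y, g (Bs ! i)} \<in> E}"
  let ?R = "set (map g Bs)"
  have fV: "finite V" using graph by (simp add: simple_graph_def)
  have R: "card ?R = ?m" using distinct_card[OF distinct_map_end[OF part(1) g]] by simp
  have RV: "?R \<subseteq> V" using part(2) g by auto
  have "nbrs E ?y \<subseteq> (\<lambda>i. g (Bs ! i)) ` ?A \<union> (V - ?R)"
  proof
    fix u assume u: "u \<in> nbrs E ?y"
    have "u \<in> V" "u \<noteq> ?y" using u nbrs_subset[OF graph] by auto
    show "u \<in> (\<lambda>i. g (Bs ! i)) ` ?A \<union> (V - ?R)"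
    proof (cases "u \<in> ?R")
      case True
      then obtain i where "i < ?m" "u = g (Bs ! i)" by (auto simp: in_set_conv_nth)
      then show ?thesis using u \<open>u \<noteq> ?y\<close> by (auto simp: nbrs_def)
    qed (use \<open>u \<in> V\<close> in auto)
  qed
  then have "card (nbrs E ?y) \<le> card ((\<lambda>i. g (Bs ! i)) ` ?A \<union> (V - ?R))"
    by (rule card_mono[rotated]) (use fV in auto)
  also have "\<dots> \<le> card ?A + card (V - ?R)"
    by (rule order_trans[OF card_Un_le]) (simp add: card_image_le)
  also have "card (V - ?R) = card V - ?m"
    using R RV by (simp add: card_Diff_subset)
  finally show ?thesis using card_mono[OF fV RV] R by simp
qed

text \<open>Cut at a bad link, so that x starts the first block, y finishes the last one and xy is a
  non-edge. If x is joined to the left end of block i and y to the right end of block i - 1,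
  reversing the first i blocks trades the closing link and one inner link for two edges. The degree
  condition is Dirac's when all blocks are single vertices.\<close>

lemma fewer_bad_links:
  assumes graph: "simple_graph V E" and part: "block_partition V E Bs"
    and deg: "\<And>v. v \<in> V \<Longrightarrow> 2 * card V \<le> 2 * degree E v + length Bs"
    and bad: "bad_links E Bs > 0" and ne: "Bs \<noteq> []"
  shows "\<exists>Cs. rearranged Bs Cs \<and> bad_links E Cs < bad_links E Bs"
proof -
  \<comment> \<open>If the closing link is good, rotate at a bad inner link.\<close>
  have "\<exists>As. rearranged Bs As \<and> bad_links E As = bad_links E Bs \<and> {rend (last As), lend (hd As)} \<notin> E"
  proof (cases "{rend (last Bs), lend (hd Bs)} \<in> E")
    case False
    then show ?thesis by (auto intro: rearranged.same)
  next
    case True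
    obtain e where "e \<in> set (closed_links Bs)" "e \<notin> E"
      using bad by (auto simp: bad_links_def filter_empty_conv)
    with True obtain Xs Ys where *: "Xs \<noteq> []" "Ys \<noteq> []" "Bs = Xs @ Ys" "e = {rend (last Xs), lend (hd Ys)}"
      using links_split[of e Bs] by (auto simp: closed_links_def)
    have "rearranged Bs (Ys @ Xs)" using * rearranged.rotate[of Bs Xs Ys] rearranged.same[of Bs] by simp
    then show ?thesis using * \<open>e \<notin> E\<close> bad_links_rotate[of E Ys Xs] by (intro exI[of _ "Ys @ Xs"]) auto
  qed
  then obtain As where As: "rearranged Bs As" "bad_links E As = bad_links E Bs"
    "{rend (last As), lend (hd As)} \<notin> E" by blast
  let ?m = "length As"
  have m: "?m = length Bs" using rearranged_length[OF As(1)] .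
  have neA: "As \<noteq> []" using m ne by auto
  have pA: "block_partition V E As" using rearranged_block_partition[OF As(1) part] .
  then have pA': "distinct (concat (map fst As))" "set (concat (map fst As)) = V"
    and blk: "\<And>B. B \<in> set As \<Longrightarrow> fst B \<noteq> []"
    by (auto simp: block_partition_def block_def)
  have le: "\<And>B. B \<in> set As \<Longrightarrow> lend B \<in> set (fst B)" and re: "\<And>B. B \<in> set As \<Longrightarrow> rend B \<in> set (fst B)"
    using blk by (auto simp: lend_def rend_def)
  define x where "x = lend (As ! 0)"
  define y where "y = rend (As ! (?m - 1))"
  have x: "x = lend (hd As)" and y: "y = rend (last As)"
    using neA by (simp_all add: x_def y_def hd_conv_nth last_conv_nth)
  have inV: "set (fst B) \<subseteq> V" if "B \<in> set As" for B using pA'(2) that by auto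
  have xV: "x \<in> V" using le[of "hd As"] inV[of "hd As"] neA x by auto
  have yV: "y \<in> V" using re[of "last As"] inV[of "last As"] neA y by auto
  define A where "A = {i. i < ?m \<and> i \<noteq> 0 \<and> {x, lend (As ! i)} \<in> E}"
  define B' where "B' = {i. i < ?m \<and> i \<noteq> ?m - 1 \<and> {y, rend (As ! i)} \<in> E}"
  \<comment> \<open>The shift makes i stand for the gap between blocks i - 1 and i, as it does in
    \<open>A\<close>.\<close>
  define B where "B = Suc ` B'"
  have cA: "degree E x + ?m \<le> card A + card V"
    using card_end_nbrs[OF graph pA' le, of 0] neA by (simp add: A_def x_def card_nbrs[OF graph])
  have "degree E y + ?m \<le> card B' + card V"
    using card_end_nbrs[OF graph pA' re, of "?m - 1"] neA by (simp add: B'_def y_def card_nbrs[OF graph])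
  then have cB: "degree E y + ?m \<le> card B + card V"
    by (simp add: B_def card_image)
  have sub: "A \<union> B \<subseteq> {1..<?m}" by (auto simp: A_def B_def B'_def)
  have fin: "finite A" "finite B" using sub by (auto intro: finite_subset)
  \<comment> \<open>Pigeonhole: the two sets have at least \<open>?m\<close> elements in total, but
    there are only \<open>?m - 1\<close> inner gaps.\<close>
  have "A \<inter> B \<noteq> {}"
  proof
    assume "A \<inter> B = {}"
    then have "card A + card B = card (A \<union> B)" using fin by (simp add: card_Un_disjoint)
    also have "\<dots> \<le> ?m - 1" using card_mono[OF _ sub] by simp
    finally show False using cA cB deg[OF xV] deg[OF yV] m neA by (cases ?m) auto
  qed
  then obtain i where i: "i \<in> A" "i \<in> B" by blast
  then have i0: "0 < i" "i < ?m" and xi: "{x, lend (As ! i)} \<in> E" and yi: "{y, rend (As ! (i - 1))} \<in> E"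
    using sub by (auto simp: A_def B_def B'_def)
  define Xs where "Xs = take i As"
  define Ys where "Ys = drop i As"
  have XY: "As = Xs @ Ys" "Xs \<noteq> []" "Ys \<noteq> []" using i0 by (auto simp: Xs_def Ys_def)
  have lX: "last Xs = As ! (i - 1)" and hY: "hd Ys = As ! i"
    using i0 neA by (auto simp: Xs_def Ys_def last_conv_nth hd_drop_conv_nth min_def)
  have blkX: "\<And>B. B \<in> set Xs \<Longrightarrow> fst B \<noteq> []" using blk XY by auto
  let ?Cs = "rev (map flip Xs) @ Ys"
  let ?bad = "\<lambda>es. length (filter (\<lambda>e. e \<notin> E) es)"
  have rA: "rearranged As ?Cs" using XY rearranged.reverse[of As Xs Ys] rearranged.same[of As] by simp
  have ends: "last (rev (map flip Xs)) = flip (hd Xs)" "hd (rev (map flip Xs)) = flip (last Xs)"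
    using XY(2) by (simp_all add: last_rev hd_rev hd_map last_map)
  have links_Cs: "links ?Cs = rev (links Xs) @ {x, lend (As ! i)} # links Ys"
    using XY links_append[of "rev (map flip Xs)" Ys] links_reverse[OF blkX] ends hY
      rend_flip[of "hd Xs"] blkX[of "hd Xs"] x by simp
  have close_Cs: "{rend (last ?Cs), lend (hd ?Cs)} = {y, rend (As ! (i - 1))}"
  proof -
    have "lend (flip (last Xs)) = rend (last Xs)" by (rule lend_flip, rule blkX) (simp add: XY(2))
    then show ?thesis using XY ends y unfolding lX[symmetric] by (simp add: hd_append)
  qed
  have "bad_links E ?Cs = ?bad (links Xs) + ?bad (links Ys)"
    unfolding bad_links_def closed_links_def links_Cs close_Cs
    using xi yi by (simp add: rev_filter[symmetric])
  \<comment> \<open>The final 1 is the bad closing link; the inner link that is given up may be good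
    or bad.\<close>
  moreover have "bad_links E As \<ge> ?bad (links Xs) + ?bad (links Ys) + 1"
    using As(3) XY by (auto simp: bad_links_def closed_links_def links_append)
  ultimately have "bad_links E ?Cs < bad_links E Bs" using As(2) by simp
  then show ?thesis using rearranged_trans[OF rA As(1)] by blast
qed

text \<open>The degree condition involves only the number of blocks, so it survives each
  rearrangement and the improvement can be iterated.\<close>

lemma no_bad_links:
  assumes graph: "simple_graph V E"
  shows "block_partition V E Bs \<Longrightarrow> (\<And>v. v \<in> V \<Longrightarrow> 2 * card V \<le> 2 * degree E v + length Bs) \<Longrightarrow>
    Bs \<noteq> [] \<Longrightarrow> \<exists>Cs. rearranged Bs Cs \<and> bad_links E Cs = 0"
proof (induction "bad_links E Bs" arbitrary: Bs rule: less_induct)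
  case less
  show ?case
  proof (cases "bad_links E Bs = 0")
    case True
    then show ?thesis by (auto intro: rearranged.same)
  next
    case False
    then obtain Cs where Cs: "rearranged Bs Cs" "bad_links E Cs < bad_links E Bs"
      using fewer_bad_links[OF graph less.prems(1,2) _ less.prems(3)] by auto
    have "length Cs = length Bs" using rearranged_length[OF Cs(1)] .
    then obtain Ds where "rearranged Cs Ds" "bad_links E Ds = 0"
      using less.hyps[OF Cs(2) rearranged_block_partition[OF Cs(1) less.prems(1)]] less.prems(2,3)
      by (metis length_0_conv)
    then show ?thesis using rearranged_trans[OF _ Cs(1)] by blast
  qed
qed

lemma hamilton_cycle_of_blocks:
  assumes part: "block_partition V E Bs" and ok: "bad_links E Bs = 0" and "3 \<le> card V"
    and f: "f = fst \<or> f = snd"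
  defines "vs \<equiv> concat (map f Bs)"
  shows "distinct vs" "length vs = card V" "hamilton_cycle V E (cycle_edges vs)"
    "cycle_edges vs = set (closed_path_edges vs)"
proof -
  have blk: "\<And>B. B \<in> set Bs \<Longrightarrow> block E B" using part by (simp add: block_partition_def)
  have "mset (concat (map snd Bs)) = mset (concat (map fst Bs))"
    using blk by (induction Bs) (auto simp: block_def)
  then have ms: "mset vs = mset (concat (map fst Bs))" using f by (auto simp: vs_def)
  show d: "distinct vs" and s: "length vs = card V"
    using ms part unfolding block_partition_def
    by (metis mset_eq_imp_distinct_iff, metis distinct_card mset_eq_length)
  have setV: "set vs = V" using ms part unfolding block_partition_def by (metis mset_eq_setD)
  have ne: "vs \<noteq> []" using s assms(3) by (metis list.size(3) not_numeral_le_zero)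
  then have neB: "Bs \<noteq> []" by (auto simp: vs_def)
  show ce: "cycle_edges vs = set (closed_path_edges vs)"
    using cycle_edges_eq_closed_path_edges[OF ne] .
  have fB: "f B \<noteq> [] \<and> hd (f B) = lend B \<and> last (f B) = rend B" if "B \<in> set Bs" for B
    using f blk[OF that] by (auto simp: block_def lend_def rend_def)
  have fE: "set (path_edges (f B)) \<subseteq> E" if "B \<in> set Bs" for B
    using f blk[OF that] by (auto simp: block_def)
  have z: "(\<Sum>B\<leftarrow>Bs. length (filter (\<lambda>e. e \<notin> E) (path_edges (f B)))) = 0"
    using fE by (auto simp: sum_list_eq_0_iff filter_empty_conv)
  have "length (filter (\<lambda>e. e \<notin> E) (closed_path_edges vs)) = 0"
    using length_filter_path_edges_concat[of Bs f "\<lambda>e. e \<notin> E"] neB fB z ok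
    by (simp add: vs_def bad_links_def)
  then have "cycle_edges vs \<subseteq> E" unfolding ce by (auto simp: filter_empty_conv)
  then show "hamilton_cycle V E (cycle_edges vs)"
    unfolding hamilton_cycle_def using d s setV assms(3) by (intro exI[of _ vs]) simp
qed

section \<open>Colour counts\<close>

definition colour_count :: "('a set \<Rightarrow> nat) \<Rightarrow> nat set \<Rightarrow> 'a set list \<Rightarrow> nat" where
  "colour_count \<chi> T es = length (filter (\<lambda>e. \<chi> e \<in> T) es)"

lemma colour_count_Cons:
  "colour_count \<chi> T (e # es) = of_bool (\<chi> e \<in> T) + colour_count \<chi> T es"
  and colour_count_Nil: "colour_count \<chi> T [] = 0"
  by (auto simp: colour_count_def)

lemma colour_count_sum: "finite T \<Longrightarrow> colour_count \<chi> T es = (\<Sum>c\<in>T. colour_count \<chi> {c} es)"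
proof (induction es)
  case (Cons e es)
  have "(\<Sum>c\<in>T. of_bool (\<chi> e \<in> {c})) = (of_bool (\<chi> e \<in> T) :: nat)"
    using Cons.prems by (simp add: of_bool_def sum.delta)
  then show ?case using Cons by (simp add: colour_count_Cons sum.distrib)
qed (simp add: colour_count_Nil)

lemma colour_count_path_flip:
  "colour_count \<chi> T (path_edges (fst (flip B))) = colour_count \<chi> T (path_edges (fst B))"
  "colour_count \<chi> T (path_edges (snd (flip B))) = colour_count \<chi> T (path_edges (snd B))"
  by (simp_all add: colour_count_def flip_def path_edges_rev rev_filter[symmetric])

text \<open>Different items may differ in different colours, so one common T is sought. Add the
  colours one at a time: for items with a nonzero entry at c, the sums over T and over T with c
  differ, so one of the two choices is nonzero on half of them. The other items are unaffected by c
  and are left to the induction.\<close>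

lemma exists_separating_subset:
  fixes d :: "'i \<Rightarrow> 'c \<Rightarrow> int"
  assumes "finite C"
  shows "finite I \<Longrightarrow> (\<And>i. i \<in> I \<Longrightarrow> \<exists>c\<in>C. d i c \<noteq> 0) \<Longrightarrow>
    \<exists>T\<subseteq>C. card I \<le> 2 * card {i \<in> I. sum (d i) T \<noteq> 0}"
  using assms
proof (induction C arbitrary: I rule: finite_induct)
  case empty
  then have "I = {}" by auto
  then show ?case by auto
next
  case (insert c C)
  define J where "J = {i \<in> I. d i c \<noteq> 0}"
  define K where "K = {i \<in> I. d i c = 0}"
  have fin: "finite J" "finite K" using insert.prems by (auto simp: J_def K_def)
  have IJK: "card I = card J + card K"
    using fin by (subst card_Un_disjoint[symmetric]) (auto simp: J_def K_def intro: arg_cong[of _ _ card])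
  have "\<And>i. i \<in> K \<Longrightarrow> \<exists>c\<in>C. d i c \<noteq> 0" using insert.prems by (auto simp: K_def)
  then obtain T where T: "T \<subseteq> C" "card K \<le> 2 * card {i \<in> K. sum (d i) T \<noteq> 0}"
    using insert.IH[OF fin(2)] by auto
  have fT: "finite T" "c \<notin> T" using T insert.hyps by (auto intro: finite_subset)
  have step: "card {i \<in> I. sum (d i) S \<noteq> 0} = card {i \<in> J. sum (d i) S \<noteq> 0} + card {i \<in> K. sum (d i) T \<noteq> 0}"
    if "S = T \<or> S = insert c T" for S
  proof -
    have "{i \<in> K. sum (d i) S \<noteq> 0} = {i \<in> K. sum (d i) T \<noteq> 0}"
      using that fT by (auto simp: K_def)
    moreover have "{i \<in> I. sum (d i) S \<noteq> 0} = {i \<in> J. sum (d i) S \<noteq> 0} \<union> {i \<in> K. sum (d i) S \<noteq> 0}"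
      by (auto simp: J_def K_def)
    moreover have "{i \<in> J. sum (d i) S \<noteq> 0} \<inter> {i \<in> K. sum (d i) S \<noteq> 0} = {}"
      by (auto simp: J_def K_def)
    ultimately show ?thesis
      using fin card_Un_disjoint[of "{i \<in> J. sum (d i) S \<noteq> 0}" "{i \<in> K. sum (d i) S \<noteq> 0}"] by simp
  qed
  have "J \<subseteq> {i \<in> J. sum (d i) T \<noteq> 0} \<union> {i \<in> J. sum (d i) (insert c T) \<noteq> 0}"
    using fT by (auto simp: J_def)
  then have "card J \<le> card {i \<in> J. sum (d i) T \<noteq> 0} + card {i \<in> J. sum (d i) (insert c T) \<noteq> 0}"
    by (intro order_trans[OF card_mono card_Un_le]) (use fin in auto)
  then have "card J \<le> 2 * card {i \<in> J. sum (d i) T \<noteq> 0} \<or> card J \<le> 2 * card {i \<in> J. sum (d i) (insert c T) \<noteq> 0}"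
    by linarith
  then have "card I \<le> 2 * card {i \<in> I. sum (d i) T \<noteq> 0} \<or> card I \<le> 2 * card {i \<in> I. sum (d i) (insert c T) \<noteq> 0}"
    using step[of T] step[of "insert c T"] T(2) IJK by auto
  moreover have "T \<subseteq> insert c C" "insert c T \<subseteq> insert c C" using T(1) by auto
  ultimately show ?case by blast
qed

lemma colour_count_hamilton_le:
  assumes bias: "\<And>H. hamilton_cycle V E H \<Longrightarrow> colour_bias r V \<chi> H \<le> b"
    and ham: "hamilton_cycle V E (set es)" and "distinct es" and T: "T \<subseteq> {1..r}"
  shows "real (colour_count \<chi> T es) \<le> real (card T) * (real (card V) / real r + b)"
proof -
  have "real (colour_count \<chi> {c} es) \<le> real (card V) / real r + b" if "c \<in> T" for c
  proof -
    have "real (card {e \<in> set es. \<chi> e = c}) - real (card V) / real r \<le> colour_bias r V \<chi> (set es)"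
      unfolding colour_bias_def using that T by (intro Max_ge) auto
    moreover have "card {e \<in> set es. \<chi> e = c} = colour_count \<chi> {c} es"
      using distinct_card[OF distinct_filter[OF assms(3), of "\<lambda>e. \<chi> e = c"]]
      by (simp add: colour_count_def)
    ultimately show ?thesis using bias[OF ham] by simp
  qed
  then have "(\<Sum>c\<in>T. real (colour_count \<chi> {c} es)) \<le> (\<Sum>c\<in>T. real (card V) / real r + b)"
    by (intro sum_mono) simp
  moreover have "finite T" using T finite_subset by blast
  ultimately show ?thesis using colour_count_sum[of T \<chi> es] by simp
qed

text \<open>Every edge has a colour in \<open>{1..r}\<close>, so an upper bound for the complement
  of T is a lower bound for T.\<close>

lemma colour_count_hamilton_ge:
  assumes bias: "\<And>H. hamilton_cycle V E H \<Longrightarrow> colour_bias r V \<chi> H \<le> b"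
    and ham: "hamilton_cycle V E (set es)" and dist: "distinct es" and T: "T \<subseteq> {1..r}"
    and col: "edge_colouring r E \<chi>"
  shows "real (length es) - (real r - real (card T)) * (real (card V) / real r + b)
    \<le> real (colour_count \<chi> T es)"
proof -
  have "\<chi> e \<in> {1..r}" if "e \<in> set es" for e
    using ham col that unfolding hamilton_cycle_def edge_colouring_def by blast
  then have "colour_count \<chi> {1..r} es = length es"
    unfolding colour_count_def by (subst filter_True) auto
  moreover have "colour_count \<chi> {1..r} es = colour_count \<chi> ({1..r} - T) es + colour_count \<chi> T es"
    using T colour_count_sum[of "{1..r}" \<chi> es] colour_count_sum[of T \<chi> es]
      colour_count_sum[of "{1..r} - T" \<chi> es] sum.subset_diff[of T "{1..r}"] finite_subset[OF T]
    by simp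
  moreover have "card ({1..r} - T) = r - card T" "card T \<le> r"
    using T finite_subset[OF T] card_mono[OF _ T] by (auto simp: card_Diff_subset)
  then have "real (card ({1..r} - T)) = real r - real (card T)" by simp
  ultimately show ?thesis
    using colour_count_hamilton_le[OF bias ham dist, of "{1..r} - T"] by simp
qed

section \<open>Switches\<close>

text \<open>Six vertices suffice for the switches constructed below; the bound limits how many
  blocks a family of switches can cost.\<close>

definition switch :: "'a set set \<Rightarrow> ('a set \<Rightarrow> nat) \<Rightarrow> 'a list \<times> 'a list \<Rightarrow> bool" where
  "switch E \<chi> B \<longleftrightarrow> block E B \<and> length (fst B) \<le> 6 \<and>
     (\<exists>c. colour_count \<chi> {c} (path_edges (fst B)) \<noteq> colour_count \<chi> {c} (path_edges (snd B)))"

lemma length_concat_le: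
  "(\<And>B. B \<in> set Bs \<Longrightarrow> length (f B) \<le> k) \<Longrightarrow> length (concat (map f Bs)) \<le> k * length Bs"
  by (induction Bs) (fastforce simp: algebra_simps intro: add_mono)+

lemma few_disjoint_switches:
  assumes graph: "simple_graph V E" and "3 \<le> card V" and "1 \<le> r"
    and col: "edge_colouring r E \<chi>"
    and bias: "\<And>H. hamilton_cycle V E H \<Longrightarrow> colour_bias r V \<chi> H \<le> b"
    and sw: "\<And>B. B \<in> set Bs \<Longrightarrow> switch E \<chi> B"
    and dist: "distinct (concat (map fst Bs))" and sub: "set (concat (map fst Bs)) \<subseteq> V"
    and deg: "\<And>v. v \<in> V \<Longrightarrow> card V + 5 * length Bs \<le> 2 * degree E v"
  shows "real (length Bs) \<le> 2 * real r * b"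
proof -
  let ?n1 = "\<lambda>T B. colour_count \<chi> T (path_edges (fst B))"
  let ?n2 = "\<lambda>T B. colour_count \<chi> T (path_edges (snd B))"
  define N where "N = length Bs"
  define d where "d i c = int (?n1 {c} (Bs ! i)) - int (?n2 {c} (Bs ! i))" for i c
  have blk: "\<And>B. B \<in> set Bs \<Longrightarrow> block E B" using sw by (auto simp: switch_def)
  \<comment> \<open>The colour in \<open>switch\<close> is unrestricted, but a colour outside
    \<open>{1..r}\<close> occurs on no edge and cannot distinguish the paths.\<close>
  have "\<exists>c\<in>{1..r}. d i c \<noteq> 0" if "i < N" for i
  proof -
    have B: "Bs ! i \<in> set Bs" using that by (simp add: N_def)
    then obtain c where c: "d i c \<noteq> 0" using sw[OF B] by (auto simp: switch_def d_def)
    have E: "set (path_edges (fst (Bs ! i))) \<subseteq> E" "set (path_edges (snd (Bs ! i))) \<subseteq> E"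
      using blk[OF B] by (auto simp: block_def)
    have "c \<in> {1..r}"
    proof (rule ccontr)
      assume "c \<notin> {1..r}"
      then have "\<And>e. e \<in> E \<Longrightarrow> \<chi> e \<noteq> c" using col by (auto simp: edge_colouring_def)
      then have "?n1 {c} (Bs ! i) = 0" "?n2 {c} (Bs ! i) = 0"
        using E by (auto simp: colour_count_def filter_empty_conv)
      then show False using c by (simp add: d_def)
    qed
    then show ?thesis using c by blast
  qed
  then obtain T where T: "T \<subseteq> {1..r}" and half: "N \<le> 2 * card {i \<in> {..<N}. sum (d i) T \<noteq> 0}"
    using exists_separating_subset[of "{1..r}" "{..<N}" d] by auto
  have fT: "finite T" using T finite_subset by blast
  have dT: "sum (d i) T = int (?n1 T (Bs ! i)) - int (?n2 T (Bs ! i))" for i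
    using colour_count_sum[OF fT, of \<chi>] by (simp add: d_def sum_subtractf)

  \<comment> \<open>Let the first path have at least as many T-coloured edges as the second, so that
    the differences add up without cancelling.\<close>
  define orient where "orient B = (if ?n1 T B < ?n2 T B then (snd B, fst B) else B)" for B
  let ?W = "set (concat (map fst Bs))"
  obtain rest where rest: "set rest = V - ?W" "distinct rest"
    using finite_distinct_list[of "V - ?W"] graph by (auto simp: simple_graph_def)
  \<comment> \<open>Uncovered vertices become one-vertex blocks.\<close>
  define Cs where "Cs = map orient Bs @ map (\<lambda>x. ([x], [x])) rest"
  have msW: "mset (concat (map (fst \<circ> orient) Bs)) = mset (concat (map fst Bs))"
    using blk by (induction Bs) (auto simp: orient_def block_def)
  have blkO: "block E (orient B)" if "B \<in> set Bs" for B
    using blk[OF that] by (auto simp: orient_def block_def)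
  have conc: "concat (map fst Cs) = concat (map (fst \<circ> orient) Bs) @ rest"
  proof -
    have "concat (map (fst \<circ> (\<lambda>x. ([x], [x]))) rest) = rest" by (induction rest) auto
    then show ?thesis by (simp add: Cs_def)
  qed
  have dW: "distinct (concat (map (fst \<circ> orient) Bs))" and sW: "set (concat (map (fst \<circ> orient) Bs)) = ?W"
    using dist msW by (metis mset_eq_imp_distinct_iff, metis msW mset_eq_setD)
  have part: "block_partition V E Cs"
    unfolding block_partition_def conc
  proof (intro conjI ballI)
    fix B assume "B \<in> set Cs"
    then consider B' where "B' \<in> set Bs" "B = orient B'" | x where "B = ([x], [x])"
      by (auto simp: Cs_def)
    then show "block E B"
    proof cases
      case 1
      then show ?thesis using blkO by simp
    next
      case 2
      then show ?thesis by (simp add: block_def)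
    qed
  next
    show "distinct (concat (map (fst \<circ> orient) Bs) @ rest)"
      unfolding distinct_append sW using dW rest by blast
    show "set (concat (map (fst \<circ> orient) Bs) @ rest) = V"
      unfolding set_append sW rest using sub by blast
  qed
  have "length (concat (map fst Bs)) \<le> 6 * N"
    unfolding N_def using sw by (intro length_concat_le) (auto simp: switch_def)
  then have cW: "card ?W \<le> 6 * N" using card_length[of "concat (map fst Bs)"] by linarith
  have fV: "finite V" using graph by (simp add: simple_graph_def)
  have "length rest = card V - card ?W"
    using rest distinct_card[of rest] sub by (simp add: card_Diff_subset)
  then have lenC: "length Cs = N + (card V - card ?W)" by (simp add: Cs_def N_def)
  have "card ?W \<le> card V" using card_mono[OF fV sub] .
  \<comment> \<open>Each switch merges at most six vertices into one block, so at least
    \<open>card V - 5 * N\<close> blocks remain.\<close>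
  then have degC: "2 * card V \<le> 2 * degree E v + length Cs" if "v \<in> V" for v
    using deg[OF that] cW lenC by (simp add: N_def)
  have "Cs \<noteq> []" using conc part assms(2) by (auto simp: block_partition_def)
  then obtain Ds where Ds: "rearranged Cs Ds" "bad_links E Ds = 0"
    using no_bad_links[OF graph part degC] by blast
  have partD: "block_partition V E Ds" using rearranged_block_partition[OF Ds(1) part] .
  have neD: "Ds \<noteq> []" using rearranged_length[OF Ds(1)] \<open>Cs \<noteq> []\<close> by auto
  have blkD: "\<And>B. B \<in> set Ds \<Longrightarrow> block E B" using partD by (simp add: block_partition_def)

  let ?L = "length (filter (\<lambda>e. \<chi> e \<in> T) (closed_links Ds))"
  let ?es1 = "closed_path_edges (concat (map fst Ds))"
  let ?es2 = "closed_path_edges (concat (map snd Ds))"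
  have ne12: "fst B \<noteq> [] \<and> hd (fst B) = lend B \<and> last (fst B) = rend B"
    "snd B \<noteq> [] \<and> hd (snd B) = lend B \<and> last (snd B) = rend B" if "B \<in> set Ds" for B
    using blkD[OF that] by (auto simp: block_def lend_def rend_def)
  have count1: "colour_count \<chi> T ?es1 = ?L + (\<Sum>B\<leftarrow>Cs. ?n1 T B)"
    using length_filter_path_edges_concat[of Ds fst "\<lambda>e. \<chi> e \<in> T"] neD ne12
      rearranged_sum_list[OF Ds(1), of "?n1 T"]
    by (simp add: colour_count_path_flip) (simp add: colour_count_def)
  have count2: "colour_count \<chi> T ?es2 = ?L + (\<Sum>B\<leftarrow>Cs. ?n2 T B)"
    using length_filter_path_edges_concat[of Ds snd "\<lambda>e. \<chi> e \<in> T"] neD ne12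
      rearranged_sum_list[OF Ds(1), of "?n2 T"]
    by (simp add: colour_count_path_flip) (simp add: colour_count_def)
  have gain: "int (\<Sum>B\<leftarrow>Cs. ?n1 T B) - int (\<Sum>B\<leftarrow>Cs. ?n2 T B) = (\<Sum>i<N. \<bar>sum (d i) T\<bar>)"
  proof -
    have *: "int (\<Sum>B\<leftarrow>Xs. ?n1 T (orient B)) - int (\<Sum>B\<leftarrow>Xs. ?n2 T (orient B))
        = (\<Sum>B\<leftarrow>Xs. \<bar>int (?n1 T B) - int (?n2 T B)\<bar>)" for Xs
      by (induction Xs) (auto simp: orient_def)
    have "(\<Sum>B\<leftarrow>Bs. \<bar>int (?n1 T B) - int (?n2 T B)\<bar>) = (\<Sum>i<N. \<bar>sum (d i) T\<bar>)"
      by (simp add: sum_list_sum_nth N_def dT atLeast0LessThan)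
    moreover have "map (?n1 T) (map (\<lambda>x. ([x], [x])) rest) = map (?n2 T) (map (\<lambda>x. ([x], [x])) rest)"
      by simp
    ultimately show ?thesis using *[of Bs] by (simp add: Cs_def o_def)
  qed
  \<comment> \<open>A nonzero integer difference contributes at least 1 to the gain.\<close>
  have "int (card {i \<in> {..<N}. sum (d i) T \<noteq> 0}) = (\<Sum>i<N. of_bool (sum (d i) T \<noteq> 0))"
    by (simp add: of_bool_def sum.If_cases Int_def)
  also have "\<dots> \<le> (\<Sum>i<N. \<bar>sum (d i) T\<bar>)"
    by (intro sum_mono) auto
  finally have "N + 2 * colour_count \<chi> T ?es2 \<le> 2 * colour_count \<chi> T ?es1"
    using half gain count1 count2 by simp
  then have large: "real N \<le> 2 * (real (colour_count \<chi> T ?es1) - real (colour_count \<chi> T ?es2))"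
    using of_nat_mono[where 'a=real] by fastforce

  note H1 = hamilton_cycle_of_blocks[OF partD Ds(2) assms(2) disjI1[OF HOL.refl]]
  note H2 = hamilton_cycle_of_blocks[OF partD Ds(2) assms(2) disjI2[OF HOL.refl]]
  have "distinct ?es1" "distinct ?es2"
    using H1(1,2) H2(1,2) assms(2) by (auto intro!: distinct_closed_path_edges)
  have len2: "length ?es2 = card V"
    using H2(2) assms(2) by (simp add: closed_path_edges_def length_path_edges)
  have "real (colour_count \<chi> T ?es1) \<le> real (card T) * (real (card V) / real r + b)"
    using colour_count_hamilton_le[OF bias _ \<open>distinct ?es1\<close> T] H1(3,4) by simp
  moreover have "real (card V) - (real r - real (card T)) * (real (card V) / real r + b)
      \<le> real (colour_count \<chi> T ?es2)"
    using colour_count_hamilton_ge[OF bias _ \<open>distinct ?es2\<close> T col] H2(3,4) len2 by simp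
  \<comment> \<open>With B = n/r + b the two bounds differ by |T| B - (n - (r - |T|) B) = r B - n,
    so \<open>card T\<close> cancels and r b remains.\<close>
  ultimately have "real (colour_count \<chi> T ?es1) - real (colour_count \<chi> T ?es2)
      \<le> real r * (real (card V) / real r + b) - real (card V)"
    unfolding left_diff_distrib by linarith
  also have "\<dots> = real r * b" using assms(3) by (simp add: field_simps)
  finally show ?thesis using large by (simp add: N_def)
qed

section \<open>Insertion switches and neighbourhoods with one inner colour\<close>

definition insertion_gain :: "('a set \<Rightarrow> nat) \<Rightarrow> 'a \<Rightarrow> 'a \<Rightarrow> 'a \<Rightarrow> nat \<Rightarrow> int" where
  "insertion_gain \<chi> v a b k =
     of_bool (\<chi> {v, a} = k) + of_bool (\<chi> {v, b} = k) - of_bool (\<chi> {a, b} = k)"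

text \<open>Both paths run from a to d and share bw and wc. The first has va, vb, cd in addition,
  the second ab, vc, vd; hence their k-counts differ by exactly the difference of the two
  gains.\<close>

lemma insertion_switch:
  assumes "{{v, a}, {v, b}, {a, b}, {v, c}, {v, d}, {c, d}, {b, w}, {c, w}} \<subseteq> E"
    and "insertion_gain \<chi> v a b k \<noteq> insertion_gain \<chi> v c d k"
  shows "switch E \<chi> ([a, v, b, w, c, d], [a, b, w, c, v, d])"
proof -
  have "block E ([a, v, b, w, c, d], [a, b, w, c, v, d])"
    using assms(1) by (auto simp: block_def insert_commute)
  moreover have "colour_count \<chi> {k} (path_edges [a, v, b, w, c, d])
      \<noteq> colour_count \<chi> {k} (path_edges [a, b, w, c, v, d])"
    using assms(2)
    by (auto simp: insertion_gain_def colour_count_Cons colour_count_Nil insert_commute)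
  ultimately show ?thesis unfolding switch_def by (simp, blast)
qed

text \<open>Here \<open>W\<close> is the vertex set of a maximal disjoint family, so no switch
  avoids it. The colour k comes from a single triangle at v, whose gain all other triangles at v
  must match.\<close>

lemma monochromatic_neighbourhood:
  assumes graph: "simple_graph V E"
    and common: "\<And>x y S. x \<in> V \<Longrightarrow> y \<in> V \<Longrightarrow> finite S \<Longrightarrow> card S \<le> 6 \<Longrightarrow>
      \<exists>z\<in>V - W - S. {x, z} \<in> E \<and> {y, z} \<in> E"
    and maximal: "\<And>p q. switch E \<chi> (p, q) \<Longrightarrow> distinct p \<Longrightarrow> set p \<subseteq> V \<Longrightarrow> set p \<inter> W \<noteq> {}"
    and "V - W \<noteq> {}"
  shows "\<exists>v\<in>V - W. \<exists>k\<in>\<chi> ` E. \<forall>x\<in>V - W. \<forall>y\<in>V - W.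
    {v, x} \<in> E \<longrightarrow> {v, y} \<in> E \<longrightarrow> {x, y} \<in> E \<longrightarrow> \<chi> {x, y} = k"
proof -
  define tri where "tri v a b \<longleftrightarrow> v \<in> V - W \<and> a \<in> V - W \<and> b \<in> V - W \<and>
    {v, a} \<in> E \<and> {v, b} \<in> E \<and> {a, b} \<in> E" for v a b
  have neq: "x \<noteq> y" if "{x, y} \<in> E" for x y
  proof
    assume "x = y"
    then have "card {x} = 2" using graph that by (auto simp: simple_graph_def)
    then show False by simp
  qed
  have disj: "insertion_gain \<chi> v a b k = insertion_gain \<chi> v c d k"
    if tri: "tri v a b" "tri v c d" and "{a, b} \<inter> {c, d} = {}" for v a b c d k
  proof (rule ccontr)
    assume ne: "insertion_gain \<chi> v a b k \<noteq> insertion_gain \<chi> v c d k"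
    \<comment> \<open>This connecting vertex completes the two disjoint edges to a switch avoiding
      \<open>W\<close>.\<close>
    obtain w where w: "w \<in> V - W" "w \<notin> {a, v, b, c, d}" "{b, w} \<in> E" "{c, w} \<in> E"
    proof -
      have "b \<in> V" "c \<in> V" using tri by (auto simp: tri_def)
      moreover have "card {a, v, b, c, d} \<le> 6" using card_length[of "[a, v, b, c, d]"] by simp
      ultimately show ?thesis using common[of b c "{a, v, b, c, d}"] that by blast
    qed
    have "switch E \<chi> ([a, v, b, w, c, d], [a, b, w, c, v, d])"
      using tri w by (intro insertion_switch[OF _ ne]) (simp add: tri_def)
    moreover have "distinct [a, v, b, w, c, d]"
      using \<open>{a, b} \<inter> {c, d} = {}\<close> tri w neq by (auto simp: tri_def)
    moreover have "set [a, v, b, w, c, d] \<subseteq> V" "set [a, v, b, w, c, d] \<inter> W = {}"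
      using tri w by (auto simp: tri_def)
    ultimately show False using maximal by blast
  qed
  \<comment> \<open>Overlapping edges are compared through a third edge xy in the neighbourhood of
    v, disjoint from both.\<close>
  have gain: "insertion_gain \<chi> v a b k = insertion_gain \<chi> v c d k"
    if tri: "tri v a b" "tri v c d" for v a b c d k
  proof -
    have vV: "v \<in> V" and S: "finite {a, b, c, d}" "card {a, b, c, d} \<le> 6"
      using tri card_length[of "[a, b, c, d]"] by (auto simp: tri_def)
    obtain x where x: "x \<in> V - W" "x \<notin> {a, b, c, d}" "{v, x} \<in> E"
      using common[of v v "{a, b, c, d}"] S vV by blast
    obtain y where y: "y \<in> V - W" "y \<notin> {a, b, c, d}" "{v, y} \<in> E" "{x, y} \<in> E"
      using common[of v x "{a, b, c, d}"] S vV x(1) by blast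
    have "tri v x y" using x y that by (simp add: tri_def)
    then show ?thesis using disj[of v a b x y k] disj[of v c d x y k] that x y by auto
  qed
  show ?thesis
  proof (cases "\<exists>v a b. tri v a b \<and> \<chi> {a, b} \<noteq> \<chi> {v, a} \<and> \<chi> {a, b} \<noteq> \<chi> {v, b}")
    case True
    then obtain v a b where vab: "tri v a b" "\<chi> {a, b} \<noteq> \<chi> {v, a}" "\<chi> {a, b} \<noteq> \<chi> {v, b}" by blast
    \<comment> \<open>The gain of colour \<open>\<chi> {a, b}\<close> is -1 here, a value that is
      attained only if the opposite edge has that colour.\<close>
    have "\<chi> {x, y} = \<chi> {a, b}" if "tri v x y" for x y
      using gain[OF vab(1) that, of "\<chi> {a, b}"] vab
      by (auto simp: insertion_gain_def of_bool_def split: if_splits)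
    then show ?thesis using vab(1) unfolding tri_def by blast
  next
    case False
    then have side: "\<chi> {a, b} = \<chi> {v, a} \<or> \<chi> {a, b} = \<chi> {v, b}" if "tri v a b" for v a b
      using that by blast
    \<comment> \<open>Seen from each of its vertices, the triangle has no edge of a colour of its
      own; three edges then share one colour.\<close>
    have mono: "\<chi> {v, a} = \<chi> {a, b} \<and> \<chi> {v, b} = \<chi> {a, b}" if "tri v a b" for v a b
    proof -
      have swap: "{a, v} = {v, a}" "{b, v} = {v, b}" "{b, a} = {a, b}" by auto
      have "tri a v b" "tri b v a" using that swap by (simp_all add: tri_def)
      then show ?thesis using side[of v a b] side[of a v b] side[of b v a] that unfolding swap by metis
    qed
    obtain v where v: "v \<in> V - W" using assms(4) by blast
    obtain a where a: "a \<in> V - W" "{v, a} \<in> E" using common[of v v "{}"] v by auto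
    obtain b where b: "b \<in> V - W" "{v, b} \<in> E" "{a, b} \<in> E" using common[of v a "{}"] v a by auto
    have vab: "tri v a b" using v a b by (simp add: tri_def)
    \<comment> \<open>A monochromatic triangle has gain 1 in its own colour and 0 in every
      other.\<close>
    have "\<chi> {x, y} = \<chi> {a, b}" if "tri v x y" for x y
      using gain[OF vab that, of "\<chi> {a, b}"] mono[OF vab] mono[OF that]
      by (auto simp: insertion_gain_def of_bool_def split: if_splits)
    then show ?thesis using vab unfolding tri_def by blast
  qed
qed

text \<open>Picking a vertex of \<open>W\<close> on each edge is injective, since matching edges are
  disjoint.\<close>

lemma card_matching_le:
  assumes "matching E' M" "finite W" "\<And>e. e \<in> M \<Longrightarrow> e \<inter> W \<noteq> {}"
  shows "card M \<le> card W"
proof -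
  have "\<forall>e\<in>M. \<exists>x. x \<in> e \<inter> W" using assms(3) by blast
  then obtain f where f: "\<And>e. e \<in> M \<Longrightarrow> f e \<in> e \<inter> W" by metis
  have "inj_on f M"
    using f assms(1) unfolding matching_def inj_on_def by (metis IntD1 disjoint_iff)
  then show ?thesis using f assms(2) by (intro card_inj_on_le[of f]) auto
qed

section \<open>A maximal family of disjoint switches and the choice of U and the colour\<close>

theorem proposition4p2:
  fixes r :: nat and \<alpha> :: real
  assumes "r \<ge> 2" and "\<alpha> = (real r + 1) / (2 * real r)"
  shows "\<exists>n\<^sub>0. \<forall>n\<ge>n\<^sub>0. \<forall>(b::real) (V::'a set) E \<chi>.
    1 \<le> b \<and> b \<le> real n / (2 ^ 10 * real r ^ 2) \<and>
    simple_graph V E \<and> card V = n \<and> real (min_degree V E) \<ge> \<alpha> * real n \<and>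
    edge_colouring r E \<chi> \<and>
    (\<forall>H. hamilton_cycle V E H \<longrightarrow> colour_bias r V \<chi> H \<le> b) \<longrightarrow>
    (\<exists>U c. U \<subseteq> V \<and> int (card U) = \<lceil>\<alpha> * real n\<rceil> \<and> c \<in> {1..r} \<and>
      (\<forall>M. matching (induced_edges E U) M \<and> (\<forall>e\<in>M. \<chi> e \<noteq> c) \<longrightarrow>
        real (card M) < 2 ^ 9 * real r * b))"
\<comment> \<open>No lower bound on n has to be chosen: the two bounds on b already force n \<ge>
  2^10 r^2.\<close>
proof (intro exI[of _ 0] allI impI, elim conjE)
  fix n b and V :: "'a set" and E \<chi>
  assume b: "1 \<le> b" "b \<le> real n / (2 ^ 10 * real r ^ 2)"
    and graph: "simple_graph V E" and n: "card V = n"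
    and mindeg: "\<alpha> * real n \<le> real (min_degree V E)"
    and col: "edge_colouring r E \<chi>"
    and bias: "\<forall>H. hamilton_cycle V E H \<longrightarrow> colour_bias r V \<chi> H \<le> b"
  define R where "R = real r * b"
  define Q where "Q = real n / real r"
  have r0: "real r > 0" using assms(1) by simp
  have R2: "2 \<le> R" using mult_mono[of 2 "real r" 1 b] assms(1) b(1) by (simp add: R_def)
  \<comment> \<open>This is the upper bound on b, rescaled; Q is the excess of twice the minimum
    degree over n.\<close>
  have QR: "1024 * R \<le> Q"
    using b(2) r0 by (simp add: R_def Q_def field_simps power2_eq_square)
  have Qn: "Q \<le> real n" using assms(1) mult_left_mono[of 1 "real r" "real n"] by (simp add: Q_def field_simps)
  have fV: "finite V" using graph by (simp add: simple_graph_def)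
  have deg: "\<alpha> * real n \<le> real (degree E v)" if "v \<in> V" for v
  proof -
    have "min_degree V E \<le> degree E v" using that fV by (simp add: min_degree_def)
    then show ?thesis using mindeg by simp
  qed
  have "2 * (\<alpha> * real n) = real n + Q" using r0 by (simp add: assms(2) Q_def field_simps)
  then have deg2: "real n + Q \<le> 2 * real (degree E v)" if "v \<in> V" for v
    using deg[OF that] by simp

  define family where "family Bs \<longleftrightarrow> (\<forall>B\<in>set Bs. switch E \<chi> B) \<and>
    distinct (concat (map fst Bs)) \<and> set (concat (map fst Bs)) \<subseteq> V" for Bs
  have small: "real (length Bs) \<le> 2 * R" if "family Bs" for Bs
  proof (rule ccontr)
    assume "\<not> real (length Bs) \<le> 2 * R"
    \<comment> \<open>A family that is too long is cut down to just over 2R members, since the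
      degree condition only allows about Q/5 switches.\<close>
    define N where "N = nat \<lfloor>2 * R\<rfloor> + 1"
    have N: "2 * R < real N" "real N \<le> 2 * R + 1" "N \<le> length Bs"
      using \<open>\<not> real (length Bs) \<le> 2 * R\<close> R2 unfolding N_def by linarith+
    define Cs where "Cs = take N Bs"
    have app: "concat (map fst Bs) = concat (map fst Cs) @ concat (map fst (drop N Bs))"
      unfolding Cs_def by (metis append_take_drop_id concat_append map_append)
    have "real (length Cs) \<le> 2 * real r * b"
    proof (rule few_disjoint_switches[OF graph _ _ col])
      show "3 \<le> card V" using n Qn QR R2 by linarith
      show "1 \<le> r" using assms(1) by simp
      show "colour_bias r V \<chi> H \<le> b" if "hamilton_cycle V E H" for H using bias that by blast
      show "switch E \<chi> B" if "B \<in> set Cs" for B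
        using \<open>family Bs\<close> that by (auto simp: family_def Cs_def dest: in_set_takeD)
      show "distinct (concat (map fst Cs))" "set (concat (map fst Cs)) \<subseteq> V"
        using \<open>family Bs\<close> unfolding family_def app by auto
      show "card V + 5 * length Cs \<le> 2 * degree E v" if "v \<in> V" for v
      proof -
        have "length Cs = N" using N(3) by (simp add: Cs_def)
        then show ?thesis using deg2[OF that] N(2) QR R2 n by linarith
      qed
    qed
    then show False using N(1,3) by (simp add: Cs_def R_def)
  qed
  \<comment> \<open>The bound \<open>small\<close> on the lengths guarantees a longest
    family.\<close>
  have "\<exists>Bs. family Bs \<and> (\<forall>Cs. family Cs \<longrightarrow> length Cs \<le> length Bs)"
  proof (rule ex_has_greatest_nat[of family "[]" length "Suc (nat \<lceil>2 * R\<rceil>)"])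
    show "family []" by (simp add: family_def)
    show "\<forall>Bs. family Bs \<longrightarrow> length Bs < Suc (nat \<lceil>2 * R\<rceil>)"
    proof (intro allI impI)
      fix Bs assume "family Bs"
      then show "length Bs < Suc (nat \<lceil>2 * R\<rceil>)" using small[of Bs] by linarith
    qed
  qed
  then obtain Bs where fam: "family Bs" and max: "\<And>Cs. family Cs \<Longrightarrow> length Cs \<le> length Bs"
    by blast
  define W where "W = set (concat (map fst Bs))"
  have "length (concat (map fst Bs)) \<le> 6 * length Bs"
    using fam by (intro length_concat_le) (auto simp: switch_def family_def)
  then have "card W \<le> 6 * length Bs"
    unfolding W_def using card_length[of "concat (map fst Bs)"] by linarith
  \<comment> \<open>At most 2R switches with at most six vertices each.\<close>
  then have cW: "real (card W) \<le> 12 * R" using small[OF fam] by linarith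
  have fW: "finite W" by (simp add: W_def)

  have "\<exists>v\<in>V - W. \<exists>k\<in>\<chi> ` E. \<forall>x\<in>V - W. \<forall>y\<in>V - W.
      {v, x} \<in> E \<longrightarrow> {v, y} \<in> E \<longrightarrow> {x, y} \<in> E \<longrightarrow> \<chi> {x, y} = k"
  proof (rule monochromatic_neighbourhood[OF graph])
    fix x y and S :: "'a set" assume xy: "x \<in> V" "y \<in> V" and S: "finite S" "card S \<le> 6"
    have "card (nbrs E x \<union> nbrs E y) \<le> card V"
      using nbrs_subset[OF graph] by (intro card_mono[OF fV]) blast
    then have "degree E x + degree E y \<le> card (nbrs E x \<inter> nbrs E y) + n"
      using card_Un_Int[OF finite_nbrs[OF graph] finite_nbrs[OF graph], of x y]
      by (simp add: card_nbrs[OF graph] n)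
    \<comment> \<open>The degrees of x and y add up to at least n + Q, so there are at least Q
      common neighbours, more than 12R + 6.\<close>
    then have "card (nbrs E x \<inter> nbrs E y) > card W + 6"
      using deg2[OF xy(1)] deg2[OF xy(2)] cW QR R2 by linarith
    moreover have "card (W \<union> S) \<le> card W + 6" using card_Un_le[of W S] S by simp
    ultimately have "\<not> nbrs E x \<inter> nbrs E y \<subseteq> W \<union> S"
      using card_mono[of "W \<union> S" "nbrs E x \<inter> nbrs E y"] fW S by auto
    then show "\<exists>z\<in>V - W - S. {x, z} \<in> E \<and> {y, z} \<in> E"
      using nbrs_subset[OF graph, of x] by (auto simp: nbrs_def)
  next
    fix p q assume pq: "switch E \<chi> (p, q)" "distinct p" "set p \<subseteq> V"
    show "set p \<inter> W \<noteq> {}"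
    proof
      assume "set p \<inter> W = {}"
      \<comment> \<open>A switch avoiding \<open>W\<close> would extend the longest family.\<close>
      then have "family ((p, q) # Bs)" using fam pq unfolding family_def W_def by auto
      then show False using max by fastforce
    qed
  next
    have "card W < card V" using cW QR Qn n R2 by linarith
    then show "V - W \<noteq> {}" using card_mono[OF fW, of V] by auto
  qed
  then obtain v k where v: "v \<in> V - W" and k: "k \<in> \<chi> ` E"
    and mono: "\<And>x y. x \<in> V - W \<Longrightarrow> y \<in> V - W \<Longrightarrow> {v, x} \<in> E \<Longrightarrow> {v, y} \<in> E \<Longrightarrow> {x, y} \<in> E \<Longrightarrow> \<chi> {x, y} = k"
    by blast
  have ceil: "\<lceil>\<alpha> * real n\<rceil> \<ge> 0" "\<lceil>\<alpha> * real n\<rceil> \<le> int (degree E v)"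
  proof -
    have "0 \<le> \<alpha> * real n" by (simp add: assms(2))
    then show "\<lceil>\<alpha> * real n\<rceil> \<ge> 0" by linarith
    show "\<lceil>\<alpha> * real n\<rceil> \<le> int (degree E v)" using deg[of v] v by (simp add: ceiling_le_iff)
  qed
  then have "nat \<lceil>\<alpha> * real n\<rceil> \<le> card (nbrs E v)"
    by (simp only: card_nbrs[OF graph] nat_le_iff)
  then obtain U where U: "U \<subseteq> nbrs E v" "card U = nat \<lceil>\<alpha> * real n\<rceil>"
    using obtain_subset_with_card_n by metis
  have UV: "U \<subseteq> V" using U nbrs_subset[OF graph, of v] by blast
  have "real (card M) < 2 ^ 9 * real r * b"
    if M: "matching (induced_edges E U) M" and Mk: "\<forall>e\<in>M. \<chi> e \<noteq> k" for M
  proof -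
    \<comment> \<open>An edge of U avoiding \<open>W\<close> lies in the neighbourhood of v outside
      \<open>W\<close>, where every edge has colour k.\<close>
    have "e \<inter> W \<noteq> {}" if "e \<in> M" for e
    proof
      assume eW: "e \<inter> W = {}"
      have e: "e \<in> E" "e \<subseteq> U" using M that by (auto simp: matching_def induced_edges_def)
      then have "card e = 2" using graph by (simp add: simple_graph_def)
      then obtain x y where xy: "e = {x, y}" by (auto simp: card_2_iff)
      then have "\<chi> e = k" using mono[of x y] e eW UV U(1) by (auto simp: nbrs_def)
      then show False using Mk that by blast
    qed
    then have "card M \<le> card W" by (rule card_matching_le[OF M fW])
    \<comment> \<open>The bound 12R already suffices; it is below 512R because R is
      positive.\<close>
    then have "real (card M) < 512 * R" using cW R2 by linarith
    then show ?thesis by (simp add: R_def)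
  qed
  moreover have "k \<in> {1..r}" using k col by (auto simp: edge_colouring_def)
  moreover have "int (card U) = \<lceil>\<alpha> * real n\<rceil>" using U(2) ceil by simp
  ultimately show "\<exists>U c. U \<subseteq> V \<and> int (card U) = \<lceil>\<alpha> * real n\<rceil> \<and> c \<in> {1..r} \<and>
      (\<forall>M. matching (induced_edges E U) M \<and> (\<forall>e\<in>M. \<chi> e \<noteq> c) \<longrightarrow>
        real (card M) < 2 ^ 9 * real r * b)"
    using UV by blast
qed

end
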